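(* Let $V$ be a digraph on $\mathcal N=\{1,\dots,N\}$ with real arc weights $v_{ij}$, and let $k\in\{1,\dots,N-1\}$ be such that $\mathcal F^k(V)\neq\emptyset$. Then every forest $F\in\tilde{\mathcal F}^{k+1}(V)$ has a descendant in $\tilde{\mathcal F}^{k}(V)$, and every forest $G\in\tilde{\mathcal F}^{k}(V)$ has an ancestor in $\tilde{\mathcal F}^{k+1}(V)$.
   Context: $V$ is a directed graph with vertex set $\mathcal N=\{1,\dots,N\}$ and arc set $\mathcal A V\subseteq\mathcal N^2$; each arc $(i,j)$ has a real weight $v_{ij}$. A forest is a digraph without directed circuits (a loop counts as a circuit) in which every vertex has outdegree $0$ or $1$; its trees are its weakly connected components; the root of a tree is its unique vertex of outdegree $0$. $T^F_i$ denotes the tree of the forest $F$ whose root is $i$, and $\mathcal V H$ the vertex set of a digraph $H$. A digraph is called a tree if it is a forest with exactly one weakly connected component. $\mathcal F^k(V)$ is the set of spanning subgraphs of $V$ (vertex set $\mathcal N$, arcs taken from $\mathcal A V$) which are forests with exactly $k$ trees. The weight of such $F$ is $\Sigma^F=\sum_{(i,j)\in\mathcal A F}v_{ij}$, $\varphi_k=\min_{F\in\mathcal F^k(V)}\Sigma^F$ ($\varphi_k=+\infty$ if $\mathcal F^k(V)=\emptyset$), and $\tilde{\mathcal F}^k(V)=\{F\in\mathcal F^k(V):\Sigma^F=\varphi_k\}$. For a digraph $H$ and $\mathcal S\subseteq\mathcal N$, $H|_{\mathcal S}$ is the induced subgraph with vertex set $\mathcal S$ and all arcs of $H$ having both endpoints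 in $\mathcal S$. For $F\in\mathcal F^{k+1}(V)$ and $G\in\mathcal F^k(V)$, $F$ is called an ancestor of $G$ (and $G$ a descendant of $F$) if the roots of $F$ can be enumerated $r_1,\dots,r_{k+1}$ so that the roots of $G$ are exactly $r_1,\dots,r_k$, $T^F_{r_i}=T^G_{r_i}$ for $i=1,\dots,k-1$, $T^F_{r_k}$ is a subgraph of $T^G_{r_k}$, and $G|_{\mathcal V T^F_{r_{k+1}}}$ is a tree. *)

theory Defs
  imports "HOL-Library.Extended_Real" "Graph_Theory.Digraph_Component"
begin

text \<open>Weakly connected components. The library's \<open>Digraph_Component.connected\<close> is
  connectedness of the underlying undirected graph (the bare name would clash with the
  topological notion).\<close>

definition wccs :: "('a, 'b) pre_digraph \<Rightarrow> ('a, 'b) pre_digraph set" where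
  "wccs G = {H. pre_digraph.max_subgraph G Digraph_Component.connected H}"

text \<open>The library's \<open>forest\<close> says that there is no directed cycle, and loops do count as cycles
  there; the arc orientation is towards the roots. Only finite digraphs are meant, and
  finiteness keeps the cardinality-based \<open>out_degree\<close> meaningful.\<close>

definition in_forest :: "('a, 'b) pre_digraph \<Rightarrow> bool" where
  "in_forest F \<longleftrightarrow> fin_digraph F \<and> forest F \<and> (\<forall>x \<in> verts F. out_degree F x \<le> 1)"

definition in_tree :: "('a, 'b) pre_digraph \<Rightarrow> bool" where
  "in_tree T \<longleftrightarrow> in_forest T \<and> card (wccs T) = 1"

definition tree_root :: "('a, 'b) pre_digraph \<Rightarrow> 'a" where
  "tree_root T = (THE x. x \<in> verts T \<and> out_degree T x = 0)"

definition roots :: "('a, 'b) pre_digraph \<Rightarrow> 'a set" where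
  "roots F = tree_root ` wccs F"

definition rooted_tree :: "('a, 'b) pre_digraph \<Rightarrow> 'a \<Rightarrow> ('a, 'b) pre_digraph" where
  "rooted_tree F r = (THE T. T \<in> wccs F \<and> tree_root T = r)"

definition spanning_forests ::
    "('a, 'b) pre_digraph \<Rightarrow> nat \<Rightarrow> ('a, 'b) pre_digraph set" where
  "spanning_forests V k = {F. spanning F V \<and> in_forest F \<and> card (wccs F) = k}"

definition weight :: "('b \<Rightarrow> real) \<Rightarrow> ('a, 'b) pre_digraph \<Rightarrow> real" where
  "weight v F = (\<Sum>e \<in> arcs F. v e)"

text \<open>A finite digraph has only finitely many spanning forests, so the infimum is a minimum;
  over the empty set it is \<open>\<infinity>\<close>.\<close>

definition min_weight :: "('a, 'b) pre_digraph \<Rightarrow> ('b \<Rightarrow> real) \<Rightarrow> nat \<Rightarrow> ereal" where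
  "min_weight V v k = (INF F \<in> spanning_forests V k. ereal (weight v F))"

definition min_forests ::
    "('a, 'b) pre_digraph \<Rightarrow> ('b \<Rightarrow> real) \<Rightarrow> nat \<Rightarrow> ('a, 'b) pre_digraph set" where
  "min_forests V v k = {F \<in> spanning_forests V k. ereal (weight v F) = min_weight V v k}"

text \<open>Meant for \<open>k \<ge> 1\<close>.\<close>

definition ancestor ::
    "('a, 'b) pre_digraph \<Rightarrow> nat \<Rightarrow> ('a, 'b) pre_digraph \<Rightarrow> ('a, 'b) pre_digraph \<Rightarrow> bool" where
  "ancestor V k F G \<longleftrightarrow>
     F \<in> spanning_forests V (k + 1) \<and> G \<in> spanning_forests V k \<and>
     (\<exists>r. bij_betw r {1..k + 1} (roots F) \<and>
          r ` {1..k} = roots G \<and>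
          (\<forall>i \<in> {1..k - 1}. rooted_tree F (r i) = rooted_tree G (r i)) \<and>
          subgraph (rooted_tree F (r k)) (rooted_tree G (r k)) \<and>
          in_tree (G \<restriction> verts (rooted_tree F (r (k + 1)))))"

abbreviation descendant ::
    "('a, 'b) pre_digraph \<Rightarrow> nat \<Rightarrow> ('a, 'b) pre_digraph \<Rightarrow> ('a, 'b) pre_digraph \<Rightarrow> bool" where
  "descendant V k G F \<equiv> ancestor V k F G"

end

theory Submission
  imports Defs
begin

text \<open>A forest is an acyclic functional relation on \<open>A\<close>, and its trees correspond to its roots.
  For forests \<open>F\<close> and \<open>G\<close> with \<open>k + 1\<close> and \<open>k\<close> trees and a set \<open>D\<close> of vertices, let the two
  forests swap the arcs leaving \<open>D\<close>; the sum of the weights does not change. So if \<open>F\<close> and \<open>G\<close>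
  are minimal and the swap yields forests with \<open>k + 1\<close> and \<open>k\<close> trees again, these are minimal too.
  Given \<open>F\<close>, choose \<open>G\<close> (or given \<open>G\<close>, choose \<open>F\<close>) with the greatest number of common arcs;
  then every such swap must be trivial. Since \<open>G\<close> has fewer roots, some tree of \<open>F\<close>, with
  vertex set \<open>S\<close> and root \<open>s\<close>, has no root of \<open>G\<close>. Swapping on \<open>S\<close> shows that \<open>F\<close> and \<open>G\<close> agree
  outside \<open>S\<close>. Let \<open>x\<close> be the vertex at which \<open>G\<close> leaves \<open>S\<close> when started in \<open>s\<close>, and \<open>U\<close> the
  set of vertices from which \<open>G\<close> leaves \<open>S\<close> at \<open>x\<close>. Swapping on \<open>U\<close> shows that \<open>F\<close> and \<open>G\<close> agree
  on \<open>S - U\<close>, so that \<open>G\<close> leaves \<open>S\<close> only at \<open>x\<close>. This is the ancestor relation.\<close>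

section \<open>Functional acyclic relations\<close>

text \<open>A cycle that meets \<open>P\<close> stays in \<open>P\<close>, and one that starts
  outside \<open>P\<close> can never enter it, as it could not return. So acyclicity may be checked
  separately on \<open>P\<close> and on its complement; this serves for the swapped relations
  below.\<close>

lemma acyclic_closed_part:
  assumes closed: "\<And>a b. (a, b) \<in> M \<Longrightarrow> a \<in> P \<Longrightarrow> b \<in> P"
    and "acyclic (M \<inter> P \<times> P)" and "acyclic (M \<inter> (- P) \<times> (- P))"
  shows "acyclic M"
proof (rule acyclicI, rule allI, rule notI)
  fix x assume cyc: "(x, x) \<in> M\<^sup>+"
  have inP: "y \<in> P \<and> (x, y) \<in> (M \<inter> P \<times> P)\<^sup>+" if "(x, y) \<in> M\<^sup>+" "x \<in> P" for y
    using that
  proof (induction rule: trancl_induct)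
    case (step y z)
    then have "(y, z) \<in> M \<inter> P \<times> P" using closed by auto
    then show ?case using step by (auto intro: trancl_into_trancl)
  qed (use closed in blast)
  have outP: "(x, y) \<in> (M \<inter> (- P) \<times> (- P))\<^sup>+" if "(x, y) \<in> M\<^sup>+" "y \<notin> P" "x \<notin> P" for y
    using that
  proof (induction rule: trancl_induct)
    case (step y z)
    then have "(y, z) \<in> M \<inter> (- P) \<times> (- P)" using closed by auto
    then show ?case using step by (auto intro: trancl_into_trancl)
  qed blast
  show False
    using cyc inP[of x] outP[of x] assms(2,3) unfolding acyclic_def by blast
qed

text \<open>The carrier is a parameter because isolated vertices are roots too. For a restriction
  \<open>G \<inter> S \<times> S\<close> the roots are the vertices of \<open>S\<close> at which
  \<open>G\<close> ends or leaves \<open>S\<close>.\<close>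

definition root_set :: "'a set \<Rightarrow> 'a rel \<Rightarrow> 'a set" where
  "root_set A E = A - Domain E"

definition tree_set :: "'a rel \<Rightarrow> 'a \<Rightarrow> 'a set" where
  "tree_set E r = {x. (x, r) \<in> E\<^sup>*}"

locale rel_forest =
  fixes A :: "'a set" and E :: "('a \<times> 'a) set"
  assumes finite_A: "finite A" and E_sub: "E \<subseteq> A \<times> A"
    and acyc: "acyclic E" and sv: "single_valued E"
begin

lemma finite_E: "finite E"
  using finite_subset[OF E_sub] finite_A by simp

text \<open>A finite acyclic relation has a well-founded converse, so following the arcs from
  \<open>x\<close> stops, and it stops at a root.\<close>

lemma ex_root:
  assumes "x \<in> A" shows "\<exists>r\<in>root_set A E. x \<in> tree_set E r"
proof -
  have "wf (E\<inverse>)"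
    by (rule finite_acyclic_wf_converse[OF finite_E acyc])
  then show ?thesis using assms
  proof (induction x rule: wf_induct_rule)
    case (less x)
    show ?case
    proof (cases "x \<in> Domain E")
      case True
      then obtain y where y: "(x, y) \<in> E" by blast
      with E_sub less.IH[of y] obtain r where "r \<in> root_set A E" "y \<in> tree_set E r" by blast
      with y show ?thesis by (auto simp: tree_set_def intro: converse_rtrancl_into_rtrancl)
    next
      case False
      with less.prems show ?thesis by (auto simp: tree_set_def root_set_def)
    qed
  qed
qed

text \<open>In a single-valued relation, of two walks from \<open>x\<close> one continues the other;
  but no walk continues beyond a root.\<close>

lemma root_unique:
  assumes "r \<in> root_set A E" "r' \<in> root_set A E" "x \<in> tree_set E r" "x \<in> tree_set E r'"
  shows "r = r'"
proof -
  have "(r, r') \<in> E\<^sup>* \<or> (r', r) \<in> E\<^sup>*"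
    using single_valued_confluent[OF sv] assms(3,4) by (auto simp: tree_set_def)
  then show ?thesis
    using assms(1,2) by (auto simp: root_set_def elim: converse_rtranclE)
qed

text \<open>The walk from \<open>x\<close> to \<open>r\<close> has to begin with the only arc
  leaving \<open>x\<close>. Hence no arc joins two different trees.\<close>

lemma tree_set_step:
  assumes "r \<in> root_set A E" "(x, y) \<in> E"
  shows "x \<in> tree_set E r \<longleftrightarrow> y \<in> tree_set E r"
proof
  assume "x \<in> tree_set E r"
  moreover have "x \<noteq> r" using assms by (auto simp: root_set_def)
  ultimately obtain z where "(x, z) \<in> E" "(z, r) \<in> E\<^sup>*"
    by (auto simp: tree_set_def elim: converse_rtranclE)
  then show "y \<in> tree_set E r"
    using sv assms(2) by (auto simp: tree_set_def dest: single_valuedD)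
qed (use assms in \<open>auto simp: tree_set_def intro: converse_rtrancl_into_rtrancl\<close>)

lemma root_in_tree_set: "r \<in> tree_set E r"
  by (simp add: tree_set_def)

lemma tree_set_subset:
  assumes "r \<in> root_set A E" shows "tree_set E r \<subseteq> A"
proof
  fix x assume "x \<in> tree_set E r"
  then show "x \<in> A"
    using assms E_sub by (auto simp: tree_set_def root_set_def elim: converse_rtranclE)
qed

lemma tree_set_Int_root_set: "r \<in> root_set A E \<Longrightarrow> tree_set E r \<inter> root_set A E = {r}"
  using root_unique root_in_tree_set by blast

lemma restrict: "S \<subseteq> A \<Longrightarrow> rel_forest S (E \<inter> S \<times> S)"
  using finite_A finite_subset acyc sv
  by unfold_locales (auto intro: acyclic_subset single_valued_subset)

end

section \<open>Forests as digraphs\<close>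

abbreviation dg :: "'a set \<Rightarrow> 'a rel \<Rightarrow> ('a, 'a \<times> 'a) pre_digraph" where
  "dg A E \<equiv> with_proj \<lparr>pverts = A, parcs = E\<rparr>"

lemma wf_digraph_dg: "E \<subseteq> A \<times> A \<Longrightarrow> wf_digraph (dg A E)"
  by unfold_locales auto

lemma dg_restrict: "dg A E \<restriction> S = dg S (E \<inter> S \<times> S)"
  by (auto simp: induce_subgraph_def with_proj_def)

text \<open>Compatibility forces a subgraph to keep \<open>fst\<close> and \<open>snd\<close> as
  tail and head, so it is determined by its vertices and arcs, and relations suffice from here
  on.\<close>

lemma subgraph_dg_iff:
  "subgraph H (dg A E) \<longleftrightarrow> E \<subseteq> A \<times> A \<and>
     (\<exists>B D. H = dg B D \<and> B \<subseteq> A \<and> D \<subseteq> E \<and> D \<subseteq> B \<times> B)"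
proof
  assume sub: "subgraph H (dg A E)"
  then have wf: "wf_digraph H" "wf_digraph (dg A E)" and "tail H = fst" "head H = snd"
    and "verts H \<subseteq> A" "arcs H \<subseteq> E"
    by (auto simp: subgraph_def compatible_def)
  moreover from this have "H = dg (verts H) (arcs H)"
    by (intro pre_digraph.equality) simp_all
  moreover have "E \<subseteq> A \<times> A"
    using wf_digraph.wellformed[OF wf(2)] by auto
  moreover have "arcs H \<subseteq> verts H \<times> verts H"
    using wf_digraph.wellformed[OF wf(1)] \<open>tail H = fst\<close> \<open>head H = snd\<close> by auto
  ultimately show "E \<subseteq> A \<times> A \<and>
     (\<exists>B D. H = dg B D \<and> B \<subseteq> A \<and> D \<subseteq> E \<and> D \<subseteq> B \<times> B)"
    by blast
qed (auto simp: subgraph_def compatible_def wf_digraph_dg)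

lemma subgraph_antisym: "subgraph G H \<Longrightarrow> subgraph H G \<Longrightarrow> G = H"
  by (auto simp: subgraph_def compatible_def intro: pre_digraph.equality)

lemma spanning_dg_iff:
  "spanning H (dg A E) \<longleftrightarrow> E \<subseteq> A \<times> A \<and> (\<exists>D \<subseteq> E. H = dg A D)"
  unfolding spanning_def subgraph_dg_iff by auto

text \<open>Nonempty walks realise the transitive closure, and every closed walk contains a
  cycle.\<close>

lemma forest_dg_iff:
  assumes "E \<subseteq> A \<times> A" shows "forest (dg A E) \<longleftrightarrow> acyclic E"
proof -
  interpret wf_digraph "dg A E" by (rule wf_digraph_dg[OF assms])
  have "(\<exists>p. cycle p) \<longleftrightarrow> (\<exists>x. (x, x) \<in> E\<^sup>+)"
  proof
    assume "\<exists>p. cycle p"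
    then show "\<exists>x. (x, x) \<in> E\<^sup>+"
      using reachable1_awalk by (auto simp: cycle_def)
  next
    assume "\<exists>x. (x, x) \<in> E\<^sup>+"
    then obtain x p where "awalk x p x" "p \<noteq> []"
      using reachable1_awalk by auto
    then have "closed_w p" by (auto simp: closed_w_def)
    then show "\<exists>p. cycle p" by (rule closed_w_imp_cycle)
  qed
  then show ?thesis by (auto simp: forest_def acyclic_def)
qed

lemma out_degree_dg_le_1_iff:
  assumes "finite E"
  shows "out_degree (dg A E) x \<le> 1 \<longleftrightarrow> (\<forall>y z. (x, y) \<in> E \<longrightarrow> (x, z) \<in> E \<longrightarrow> y = z)"
proof -
  have "finite (out_arcs (dg A E) x)"
    using assms by (auto simp: out_arcs_def)
  then show ?thesis
    by (fastforce simp: out_degree_def card_le_Suc0_iff_eq)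
qed

lemma out_degree_dg_eq_0_iff:
  "finite E \<Longrightarrow> out_degree (dg A E) x = 0 \<longleftrightarrow> x \<notin> Domain E"
  by (auto simp: out_degree_def out_arcs_def)

lemma in_forest_dg_iff:
  assumes "finite A" "E \<subseteq> A \<times> A"
  shows "in_forest (dg A E) \<longleftrightarrow> rel_forest A E"
proof -
  have fin: "finite E" using finite_subset[OF assms(2)] assms(1) by simp
  have "fin_digraph (dg A E)"
    using assms fin by (intro wf_digraph.fin_digraphI wf_digraph_dg) auto
  moreover have "(\<forall>x\<in>A. out_degree (dg A E) x \<le> 1) \<longleftrightarrow> single_valued E"
    using assms(2) unfolding out_degree_dg_le_1_iff[OF fin] single_valued_def by blast
  ultimately show ?thesis
    unfolding in_forest_def rel_forest_def using assms forest_dg_iff[OF assms(2)] by simp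
qed

lemma connected_dg_iff:
  assumes "E \<subseteq> A \<times> A"
  shows "Digraph_Component.connected (dg A E) \<longleftrightarrow>
    A \<noteq> {} \<and> (\<forall>x\<in>A. \<forall>y\<in>A. (x, y) \<in> (E \<union> E\<inverse>)\<^sup>*)"
proof -
  have "parcs (mk_symmetric (dg A E)) = E \<union> E\<inverse>"
    by (auto simp: parcs_mk_symmetric)
  moreover have "wf_digraph (with_proj (mk_symmetric (dg A E)))"
    using wf_digraph.wellformed_mk_symmetric[OF wf_digraph_dg[OF assms]]
    by (simp add: wf_digraph_wp_iff)
  ultimately show ?thesis
    by (auto simp: connected_def strongly_connected_def wf_digraph.reachable_conv)
qed

section \<open>Weak components of a forest\<close>

context rel_forest
begin

lemma connected_tree:
  assumes r: "r \<in> root_set A E"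
  shows "Digraph_Component.connected (dg A E \<restriction> tree_set E r)"
proof -
  let ?D = "E \<inter> tree_set E r \<times> tree_set E r"
  have to_r: "(x, r) \<in> ?D\<^sup>*" if "x \<in> tree_set E r" for x
  proof -
    have "(x, r) \<in> E\<^sup>*" using that by (simp add: tree_set_def)
    then show ?thesis
    proof (induction rule: converse_rtrancl_induct)
      case (step y z)
      then have "(y, z) \<in> ?D"
        by (auto simp: tree_set_def intro: converse_rtrancl_into_rtrancl)
      then show ?case using step by (auto intro: converse_rtrancl_into_rtrancl)
    qed simp
  qed
  \<comment> \<open>Go down from \<open>x\<close> to the root, then back up to \<open>y\<close>
    against the arcs.\<close>
  have "(x, y) \<in> (?D \<union> ?D\<inverse>)\<^sup>*" if "x \<in> tree_set E r" "y \<in> tree_set E r" for x y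
  proof -
    have "(x, r) \<in> (?D \<union> ?D\<inverse>)\<^sup>*"
      by (rule subsetD[OF rtrancl_mono[OF Un_upper1] to_r[OF that(1)]])
    moreover have "(r, y) \<in> (?D \<union> ?D\<inverse>)\<^sup>*"
      by (rule subsetD[OF rtrancl_mono[OF Un_upper2] rtrancl_converseI[OF to_r[OF that(2)]]])
    ultimately show ?thesis by (rule rtrancl_trans)
  qed
  then show ?thesis
    unfolding dg_restrict connected_dg_iff[OF Int_lower2] using root_in_tree_set by blast
qed

lemma connected_subset_tree:
  assumes "B \<subseteq> A" "D \<subseteq> E" "D \<subseteq> B \<times> B" "Digraph_Component.connected (dg B D)"
  obtains r where "r \<in> root_set A E" "B \<subseteq> tree_set E r"
proof -
  from assms(3,4) have ne: "B \<noteq> {}" and con: "\<And>x y. x \<in> B \<Longrightarrow> y \<in> B \<Longrightarrow> (x, y) \<in> (D \<union> D\<inverse>)\<^sup>*"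
    unfolding connected_dg_iff[OF assms(3)] by blast+
  then obtain x where x: "x \<in> B" by blast
  with assms(1) ex_root obtain r where r: "r \<in> root_set A E" "x \<in> tree_set E r" by blast
  have "y \<in> tree_set E r" if "(x, y) \<in> (D \<union> D\<inverse>)\<^sup>*" for y
    using that
  proof (induction rule: rtrancl_induct)
    case (step y z)
    then have "(y, z) \<in> E \<or> (z, y) \<in> E" using assms(2) by blast
    then show ?case using tree_set_step[OF r(1)] step.IH by blast
  qed (rule r(2))
  then show ?thesis using con[OF x] by (intro that[OF r(1)]) blast
qed

text \<open>The trees are connected and every connected subgraph lies in one of them. Since
  different trees are incomparable, they are exactly the maximal connected subgraphs.\<close>

lemma wccs_dg: "wccs (dg A E) = (\<lambda>r. dg A E \<restriction> tree_set E r) ` root_set A E"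
proof (rule set_eqI)
  fix H
  let ?max = "pre_digraph.max_subgraph (dg A E) Digraph_Component.connected"
  have tree_sub: "subgraph (dg A E \<restriction> tree_set E r) (dg A E)" if "r \<in> root_set A E" for r
    unfolding dg_restrict subgraph_dg_iff using E_sub tree_set_subset[OF that] by blast
  have into_tree: "\<exists>r\<in>root_set A E. subgraph H (dg A E \<restriction> tree_set E r)"
    if "subgraph H (dg A E)" "Digraph_Component.connected H" for H
  proof -
    from that(1) obtain B D where H: "H = dg B D" "B \<subseteq> A" "D \<subseteq> E" "D \<subseteq> B \<times> B"
      by (auto simp: subgraph_dg_iff)
    with that(2) obtain r where r: "r \<in> root_set A E" "B \<subseteq> tree_set E r"
      using connected_subset_tree by blast
    then have "subgraph H (dg A E \<restriction> tree_set E r)"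
      unfolding dg_restrict subgraph_dg_iff using H by blast
    with r show ?thesis by blast
  qed
  have "?max H" if r: "r \<in> root_set A E" and H: "H = dg A E \<restriction> tree_set E r" for r
  proof -
    have "H' = H" if H': "subgraph H H'" "subgraph H' (dg A E)" "Digraph_Component.connected H'" for H'
    proof -
      from into_tree[OF H'(2,3)] obtain r' where
        r': "r' \<in> root_set A E" "subgraph H' (dg A E \<restriction> tree_set E r')" by blast
      with H'(1) H have "tree_set E r \<subseteq> tree_set E r'"
        by (auto simp: subgraph_def)
      then have "r = r'"
        using root_unique[OF r r'(1)] root_in_tree_set by blast
      with r' H' H show ?thesis
        using subgraph_antisym by blast
    qed
    then show ?thesis
      unfolding pre_digraph.max_subgraph_def H using tree_sub[OF r] connected_tree[OF r] H by blast
  qed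
  moreover have "H \<in> (\<lambda>r. dg A E \<restriction> tree_set E r) ` root_set A E" if "?max H"
  proof -
    have H: "subgraph H (dg A E)" "Digraph_Component.connected H"
      using that by (auto simp: pre_digraph.max_subgraph_def)
    from into_tree[OF this] obtain r where
      r: "r \<in> root_set A E" "subgraph H (dg A E \<restriction> tree_set E r)" by blast
    with that have "dg A E \<restriction> tree_set E r = H"
      using tree_sub connected_tree unfolding pre_digraph.max_subgraph_def by blast
    with r show ?thesis by blast
  qed
  ultimately show "H \<in> wccs (dg A E) \<longleftrightarrow> H \<in> (\<lambda>r. dg A E \<restriction> tree_set E r) ` root_set A E"
    unfolding wccs_def by blast
qed

text \<open>Arcs leaving a vertex of the tree stay in the tree, so the restriction creates no new
  vertex of outdegree 0.\<close>

lemma tree_root_tree: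
  assumes "r \<in> root_set A E" shows "tree_root (dg A E \<restriction> tree_set E r) = r"
proof -
  have fin: "finite (E \<inter> tree_set E r \<times> tree_set E r)" using finite_E by simp
  have "x \<in> tree_set E r \<and> x \<notin> Domain (E \<inter> tree_set E r \<times> tree_set E r) \<longleftrightarrow> x = r" for x
  proof -
    have "x \<in> Domain (E \<inter> tree_set E r \<times> tree_set E r) \<longleftrightarrow> x \<in> Domain E" if "x \<in> tree_set E r"
      using tree_set_step[OF assms] that by blast
    then show ?thesis
      using tree_set_Int_root_set[OF assms] tree_set_subset[OF assms]
      unfolding root_set_def by blast
  qed
  then show ?thesis
    unfolding tree_root_def dg_restrict out_degree_dg_eq_0_iff[OF fin] by simp
qed

lemma roots_dg: "roots (dg A E) = root_set A E"
  unfolding roots_def wccs_dg image_image using tree_root_tree by simp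

lemma card_wccs_dg: "card (wccs (dg A E)) = card (root_set A E)"
  unfolding wccs_dg by (intro card_image inj_on_inverseI[where g = tree_root] tree_root_tree)

lemma rooted_tree_dg:
  assumes "r \<in> root_set A E" shows "rooted_tree (dg A E) r = dg A E \<restriction> tree_set E r"
  unfolding rooted_tree_def wccs_dg
  using assms tree_root_tree by (intro the_equality) auto

end

section \<open>Exchanging arcs\<close>

text \<open>\<open>mix D F G\<close> and \<open>mix D G F\<close> are the two results of a swap on
  \<open>D\<close>. Selecting arcs by their tails keeps both single-valued, so only acyclicity and
  the number of roots remain to be checked.\<close>

definition mix :: "'a set \<Rightarrow> 'a rel \<Rightarrow> 'a rel \<Rightarrow> 'a rel" where
  "mix D X Y = {(a, b). if a \<in> D then (a, b) \<in> X else (a, b) \<in> Y}"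

lemma mem_mix: "(a, b) \<in> mix D X Y \<longleftrightarrow> (if a \<in> D then (a, b) \<in> X else (a, b) \<in> Y)"
  by (simp add: mix_def)

lemma mix_subset: "mix D X Y \<subseteq> X \<union> Y"
  by (auto simp: mem_mix split: if_splits)

lemma single_valued_mix: "single_valued X \<Longrightarrow> single_valued Y \<Longrightarrow> single_valued (mix D X Y)"
  unfolding single_valued_def mem_mix by (simp split: if_splits)

lemma root_set_mix: "root_set A (mix D X Y) = root_set A X \<inter> D \<union> (root_set A Y - D)"
proof -
  have "Domain (mix D X Y) = Domain X \<inter> D \<union> (Domain Y - D)"
    unfolding mix_def by (auto split: if_splits)
  then show ?thesis unfolding root_set_def by blast
qed

lemma sum_mix:
  fixes w :: "'a \<times> 'a \<Rightarrow> real"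
  assumes "finite X" "finite Y"
  shows "sum w (mix D X Y) + sum w (mix D Y X) = sum w X + sum w Y"
proof -
  have split: "sum w (mix D X Y) = sum w (X \<inter> D \<times> UNIV) + sum w (Y - D \<times> UNIV)"
    if "finite X" "finite Y" for X Y
  proof -
    have "mix D X Y = (X \<inter> D \<times> UNIV) \<union> (Y - D \<times> UNIV)"
      by (auto simp: mem_mix split: if_splits)
    then show ?thesis
      using that by (simp add: sum.union_disjoint disjoint_iff)
  qed
  have "sum w X = sum w (X \<inter> D \<times> UNIV) + sum w (X - D \<times> UNIV)"
    "sum w Y = sum w (Y \<inter> D \<times> UNIV) + sum w (Y - D \<times> UNIV)"
    using assms by (simp_all add: sum.Int_Diff)
  then show ?thesis
    using split assms by simp
qed

section \<open>Minimal forests as relations and swaps between them\<close>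

definition rel_forests :: "'a set \<Rightarrow> 'a rel \<Rightarrow> nat \<Rightarrow> 'a rel set" where
  "rel_forests A V k = {E. E \<subseteq> V \<and> rel_forest A E \<and> card (root_set A E) = k}"

definition min_rel_forests :: "'a set \<Rightarrow> 'a rel \<Rightarrow> ('a \<times> 'a \<Rightarrow> real) \<Rightarrow> nat \<Rightarrow> 'a rel set" where
  "min_rel_forests A V w k =
    {E \<in> rel_forests A V k. \<forall>E' \<in> rel_forests A V k. sum w E \<le> sum w E'}"

lemma rel_forestsI_mix:
  assumes "E \<in> rel_forests A V i" "E' \<in> rel_forests A V j"
    and "acyclic (mix D E E')" "card (root_set A (mix D E E')) = k"
  shows "mix D E E' \<in> rel_forests A V k"
  using assms mix_subset[of D E E'] single_valued_mix[of E E' D]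
  unfolding rel_forests_def rel_forest_def by blast

text \<open>Equally many roots turn the inclusion of root sets into equality. Then the domains
  agree, and a single-valued relation has no proper extension that is single-valued on the same
  domain.\<close>

lemma rel_forest_eqI:
  assumes "rel_forest A E" "rel_forest A E'" "E \<subseteq> E'"
    and "card (root_set A E) = card (root_set A E')"
  shows "E = E'"
proof -
  interpret E: rel_forest A E by fact
  interpret E': rel_forest A E' by fact
  have "root_set A E' = root_set A E"
    using assms(3,4) E.finite_A by (intro card_subset_eq) (auto simp: root_set_def)
  then have dom: "Domain E' = Domain E"
    using E.E_sub E'.E_sub unfolding root_set_def by blast
  have "(a, b) \<in> E" if "(a, b) \<in> E'" for a b
  proof -
    from that dom obtain c where "(a, c) \<in> E" by blast
    with that assms(3) show ?thesis using single_valuedD[OF E'.sv that] by blast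
  qed
  with assms(3) show ?thesis by auto
qed

text \<open>The total weight is preserved and neither forest can drop below its minimum, so neither
  weight changes.\<close>

lemma mix_min_rel_forests:
  assumes "F \<in> min_rel_forests A V w i" "G \<in> min_rel_forests A V w j"
    and "mix D F G \<in> rel_forests A V i" "mix D G F \<in> rel_forests A V j"
  shows "mix D F G \<in> min_rel_forests A V w i" "mix D G F \<in> min_rel_forests A V w j"
proof -
  have "finite F" "finite G"
    using assms(1,2) rel_forest.finite_E by (auto simp: min_rel_forests_def rel_forests_def)
  then have "sum w (mix D F G) + sum w (mix D G F) = sum w F + sum w G"
    by (rule sum_mix)
  moreover have "sum w F \<le> sum w (mix D F G)" "sum w G \<le> sum w (mix D G F)"
    using assms by (auto simp: min_rel_forests_def)
  ultimately have "sum w (mix D F G) = sum w F" "sum w (mix D G F) = sum w G"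
    by linarith+
  then show "mix D F G \<in> min_rel_forests A V w i" "mix D G F \<in> min_rel_forests A V w j"
    using assms by (auto simp: min_rel_forests_def)
qed

text \<open>The weight-free core: \<open>stable\<close> is all that is kept of minimality and of the
  extremal choice. The vertex \<open>x\<close> is the only one at which \<open>G\<close> leaves the
  tree of \<open>s\<close> in \<open>F\<close>.\<close>

lemma exchange_stable_imp_unique_exit:
  assumes F: "F \<in> rel_forests A V (k + 1)" and G: "G \<in> rel_forests A V k"
    and stable: "\<And>D. mix D F G \<in> rel_forests A V (k + 1) \<Longrightarrow> mix D G F \<in> rel_forests A V k \<Longrightarrow>
      mix D F G = F"
  obtains s x where "s \<in> root_set A F" "root_set A G = root_set A F - {s}"
    "\<And>a b. a \<notin> tree_set F s \<Longrightarrow> (a, b) \<in> G \<longleftrightarrow> (a, b) \<in> F"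
    "root_set (tree_set F s) (G \<inter> tree_set F s \<times> tree_set F s) = {x}"
proof -
  interpret F: rel_forest A F using F by (simp add: rel_forests_def)
  interpret G: rel_forest A G using G by (simp add: rel_forests_def)
  have finite_roots: "finite (root_set A F)" "finite (root_set A G)"
    using F.finite_A by (auto simp: root_set_def)
  have card_roots: "card (root_set A F) = k + 1" "card (root_set A G) = k"
    using F G by (auto simp: rel_forests_def)
  \<comment> \<open>Pigeonhole: picking a root of \<open>G\<close> in each tree of \<open>F\<close>
    would be injective, as the trees are disjoint.\<close>
  have "\<exists>s\<in>root_set A F. tree_set F s \<inter> root_set A G = {}"
  proof (rule ccontr)
    assume "\<not> ?thesis"
    then have "\<forall>s\<in>root_set A F. \<exists>g. g \<in> tree_set F s \<and> g \<in> root_set A G" by blast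
    then obtain g where g: "\<And>s. s \<in> root_set A F \<Longrightarrow> g s \<in> tree_set F s \<and> g s \<in> root_set A G"
      by metis
    have "inj_on g (root_set A F)"
      using g F.root_unique by (metis inj_onI)
    then have "card (root_set A F) \<le> card (root_set A G)"
      using g finite_roots by (intro card_inj_on_le) auto
    with card_roots show False by simp
  qed
  then obtain s where s: "s \<in> root_set A F" and S_G: "tree_set F s \<inter> root_set A G = {}" by blast
  define S where "S = tree_set F s"
  have SA: "S \<subseteq> A" and sS: "s \<in> S"
    using F.tree_set_subset[OF s] F.root_in_tree_set by (auto simp: S_def)
  have stepF: "a \<in> S \<longleftrightarrow> b \<in> S" if "(a, b) \<in> F" for a b
    using F.tree_set_step[OF s that] by (simp add: S_def)
  have S_F: "S \<inter> root_set A F = {s}"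
    using F.tree_set_Int_root_set[OF s] by (simp add: S_def)
  note S_G = S_G[folded S_def]
  have card_insert: "card (insert s (root_set A G)) = k + 1"
    using card_roots finite_roots sS S_G by (subst card_insert_disjoint) auto
  have card_remove: "card (root_set A F - {s}) = k"
    using card_roots s by simp

  \<comment> \<open>As \<open>s\<close> is the only root of \<open>F\<close> in \<open>S\<close> and
    \<open>G\<close> has none there, a swap on \<open>D\<close> adds \<open>s\<close> to the roots
    of \<open>G\<close> and removes it from those of \<open>F\<close>. The counts are
    \<open>k + 1\<close> and \<open>k\<close>, so acyclicity alone makes \<open>stable\<close>
    applicable.\<close>
  have agree: "(a, b) \<in> G \<longleftrightarrow> (a, b) \<in> F"
    if D: "s \<in> D" "D \<subseteq> S" and acyclic: "acyclic (mix D F G)" "acyclic (mix D G F)"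
      and "a \<notin> D" for D a b
  proof -
    have "root_set A (mix D F G) = insert s (root_set A G)"
      "root_set A (mix D G F) = root_set A F - {s}"
      using D S_F S_G unfolding root_set_mix by blast+
    then have "mix D F G = F"
      using card_insert card_remove acyclic F G
      by (intro stable rel_forestsI_mix) auto
    then show ?thesis
      using \<open>a \<notin> D\<close> mem_mix[of a b D F G] by simp
  qed

  have agree_S: "(a, b) \<in> G \<longleftrightarrow> (a, b) \<in> F" if "a \<notin> S" for a b
  proof (rule agree[OF sS order_refl _ _ that])
    \<comment> \<open>\<open>S\<close> is a tree of \<open>F\<close>, so arcs of \<open>F\<close>
      neither leave nor enter it: \<open>S\<close> is closed here, its complement in the other
      mix.\<close>
    show "acyclic (mix S F G)"
    proof (rule acyclic_closed_part[where P = S])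
      show "acyclic (mix S F G \<inter> S \<times> S)"
        by (rule acyclic_subset[OF F.acyc]) (auto simp: mem_mix)
      show "acyclic (mix S F G \<inter> (- S) \<times> (- S))"
        by (rule acyclic_subset[OF G.acyc]) (auto simp: mem_mix)
    qed (use stepF in \<open>auto simp: mem_mix split: if_splits\<close>)
    show "acyclic (mix S G F)"
    proof (rule acyclic_closed_part[where P = "- S"])
      show "acyclic (mix S G F \<inter> (- S) \<times> (- S))"
        by (rule acyclic_subset[OF F.acyc]) (auto simp: mem_mix)
      show "acyclic (mix S G F \<inter> (- (- S)) \<times> (- (- S)))"
        by (rule acyclic_subset[OF G.acyc]) (auto simp: mem_mix)
    qed (use stepF in \<open>auto simp: mem_mix split: if_splits\<close>)
  qed
  have roots_G: "root_set A G = root_set A F - {s}"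
  proof -
    have "root_set A G - S = root_set A F - S"
      using agree_S by (auto simp: root_set_def Domain_iff)
    then show ?thesis using S_F S_G by blast
  qed

  define GS where "GS = G \<inter> S \<times> S"
  interpret GS: rel_forest S GS
    unfolding GS_def by (rule G.restrict[OF SA])
  \<comment> \<open>Since \<open>S\<close> contains no root of \<open>G\<close>, a root of
    \<open>GS\<close> is a vertex whose arc in \<open>G\<close> leaves \<open>S\<close>.\<close>
  obtain x where x: "x \<in> root_set S GS" and sx: "s \<in> tree_set GS x"
    using GS.ex_root[OF sS] by blast
  define U where "U = tree_set GS x"
  have US: "U \<subseteq> S" and sU: "s \<in> U"
    using GS.tree_set_subset[OF x] sx by (auto simp: U_def)
  have stepG: "a \<in> U \<longleftrightarrow> b \<in> U" if "(a, b) \<in> G" "a \<in> S" "b \<in> S" for a b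
    using GS.tree_set_step[OF x, of a b] that by (simp add: U_def GS_def)
  have agree_U: "(a, b) \<in> G \<longleftrightarrow> (a, b) \<in> F" if "a \<notin> U" for a b
  proof (rule agree[OF sU US _ _ that])
    show "acyclic (mix U F G)"
    proof (rule acyclic_closed_part[where P = "- U"])
      show "acyclic (mix U F G \<inter> (- U) \<times> (- U))"
        by (rule acyclic_subset[OF G.acyc]) (auto simp: mem_mix)
      show "acyclic (mix U F G \<inter> (- (- U)) \<times> (- (- U)))"
        by (rule acyclic_subset[OF F.acyc]) (auto simp: mem_mix)
      \<comment> \<open>Within \<open>S\<close>, arcs of \<open>G\<close> respect \<open>U\<close>;
        outside \<open>S\<close> they are arcs of \<open>F\<close> and do not enter
        \<open>S\<close>.\<close>
      show "b \<in> - U" if "(a, b) \<in> mix U F G" "a \<in> - U" for a b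
      proof
        assume "b \<in> U"
        from that have ab: "(a, b) \<in> G" "a \<notin> U" by (auto simp: mem_mix)
        show False
        proof (cases "a \<in> S")
          case True
          then show False using stepG[OF ab(1)] ab(2) \<open>b \<in> U\<close> US by blast
        next
          case False
          then show False using agree_S stepF ab(1) \<open>b \<in> U\<close> US by blast
        qed
      qed
    qed
    \<comment> \<open>Two splittings: arcs starting outside \<open>S\<close> belong to
      \<open>F\<close> and stay outside; inside \<open>S\<close>, arcs starting in \<open>U\<close>
      belong to \<open>G\<close> and stay in \<open>U\<close>.\<close>
    show "acyclic (mix U G F)"
    proof (rule acyclic_closed_part[where P = "- S"])
      show "acyclic (mix U G F \<inter> (- S) \<times> (- S))"
        using US by (intro acyclic_subset[OF F.acyc]) (auto simp: mem_mix split: if_splits)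
      show "acyclic (mix U G F \<inter> (- (- S)) \<times> (- (- S)))"
      proof (rule acyclic_closed_part[where P = U])
        show "acyclic (mix U G F \<inter> (- (- S)) \<times> (- (- S)) \<inter> U \<times> U)"
          by (rule acyclic_subset[OF G.acyc]) (auto simp: mem_mix)
        show "acyclic (mix U G F \<inter> (- (- S)) \<times> (- (- S)) \<inter> (- U) \<times> (- U))"
          by (rule acyclic_subset[OF F.acyc]) (auto simp: mem_mix)
      qed (use stepG in \<open>auto simp: mem_mix\<close>)
      show "b \<in> - S" if "(a, b) \<in> mix U G F" "a \<in> - S" for a b
        using that US stepF by (auto simp: mem_mix split: if_splits)
    qed
  qed
  have "root_set S GS = {x}"
  proof -
    have "y = x" if y: "y \<in> root_set S GS" for y
    proof (cases "y \<in> U")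
      case True
      then show ?thesis
        using GS.root_unique[OF y x GS.root_in_tree_set] by (simp add: U_def)
    next
      \<comment> \<open>The arc of \<open>G\<close> leaving \<open>y\<close> is an arc of
        \<open>F\<close> by \<open>agree_U\<close>, so it stays in \<open>S\<close>, and
        \<open>y\<close> is no root of \<open>GS\<close>.\<close>
      case False
      have yS: "y \<in> S" using y by (simp add: root_set_def)
      then obtain z where z: "(y, z) \<in> G"
        using S_G SA by (auto simp: root_set_def)
      then have "z \<in> S"
        using agree_U[OF False] stepF yS by blast
      then show ?thesis
        using y yS z by (auto simp: root_set_def GS_def)
    qed
    then show ?thesis using x by blast
  qed
  then show ?thesis
    using that[OF s roots_G] agree_S unfolding GS_def S_def by blast
qed

section \<open>Minimal forests\<close>

lemma spanning_forests_dg: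
  assumes "finite A" "V \<subseteq> A \<times> A"
  shows "spanning_forests (dg A V) k = dg A ` rel_forests A V k"
proof -
  have "H \<in> spanning_forests (dg A V) k \<longleftrightarrow>
      (\<exists>E \<subseteq> V. H = dg A E \<and> in_forest (dg A E) \<and> card (wccs (dg A E)) = k)" for H
    using assms(2) unfolding spanning_forests_def spanning_dg_iff by blast
  moreover have "in_forest (dg A E) \<and> card (wccs (dg A E)) = k \<longleftrightarrow>
      rel_forest A E \<and> card (root_set A E) = k" if "E \<subseteq> V" for E
    using in_forest_dg_iff[of A E] rel_forest.card_wccs_dg[of A E] that assms by auto
  ultimately show ?thesis
    unfolding rel_forests_def by blast
qed

text \<open>A member of the family attains the infimum iff it is a lower bound, which removes the
  extended reals.\<close>

lemma min_forests_dg: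
  assumes "finite A" "V \<subseteq> A \<times> A"
  shows "min_forests (dg A V) w k = dg A ` min_rel_forests A V w k"
proof -
  have weight: "weight w (dg A E) = sum w E" for E
    by (simp add: weight_def)
  have min: "ereal (sum w E) = min_weight (dg A V) w k \<longleftrightarrow>
      (\<forall>E' \<in> rel_forests A V k. sum w E \<le> sum w E')" if "E \<in> rel_forests A V k" for E
  proof -
    have "min_weight (dg A V) w k = (INF E' \<in> rel_forests A V k. ereal (sum w E'))"
      unfolding min_weight_def spanning_forests_dg[OF assms] image_image weight ..
    moreover have "(INF E' \<in> rel_forests A V k. ereal (sum w E')) \<le> ereal (sum w E)"
      using that by (rule INF_lower)
    ultimately show ?thesis
      using le_INF_iff[of "ereal (sum w E)" "\<lambda>E'. ereal (sum w E')" "rel_forests A V k"]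
      by (auto simp: antisym_conv)
  qed
  show ?thesis
    unfolding min_forests_def min_rel_forests_def spanning_forests_dg[OF assms]
    using min by (auto simp: weight)
qed

text \<open>The root \<open>s\<close> plays the part of \<open>r (k + 1)\<close>. The part of
  \<open>r k\<close> falls to the root \<open>q\<close> of the tree of \<open>F\<close> that
  \<open>G\<close> enters on leaving \<open>S\<close> at \<open>x\<close>; the tree of
  \<open>q\<close> absorbs \<open>S\<close>.\<close>

lemma ancestor_dg:
  assumes V: "V \<subseteq> A \<times> A"
    and F: "F \<in> rel_forests A V (k + 1)" and G: "G \<in> rel_forests A V k"
    and stable: "\<And>D. mix D F G \<in> rel_forests A V (k + 1) \<Longrightarrow> mix D G F \<in> rel_forests A V k \<Longrightarrow>
      mix D F G = F"
  shows "ancestor (dg A V) k (dg A F) (dg A G)"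
proof -
  interpret F: rel_forest A F using F by (simp add: rel_forests_def)
  interpret G: rel_forest A G using G by (simp add: rel_forests_def)
  obtain s x where s: "s \<in> root_set A F" and roots: "root_set A G = root_set A F - {s}"
    and agree: "\<And>a b. a \<notin> tree_set F s \<Longrightarrow> (a, b) \<in> G \<longleftrightarrow> (a, b) \<in> F"
    and exit: "root_set (tree_set F s) (G \<inter> tree_set F s \<times> tree_set F s) = {x}"
    using exchange_stable_imp_unique_exit[OF F G stable] by blast
  define S where "S = tree_set F s"
  define GS where "GS = G \<inter> S \<times> S"
  note agree = agree[folded S_def] and exit = exit[folded S_def, folded GS_def]
  have SA: "S \<subseteq> A" using F.tree_set_subset[OF s] by (simp add: S_def)
  interpret GS: rel_forest S GS
    unfolding GS_def by (rule G.restrict[OF SA])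
  have S_disj: "S \<inter> tree_set F r = {}" if "r \<in> root_set A G" for r
    using F.root_unique[OF s] that roots unfolding S_def by blast
  have xS: "x \<in> S" using exit by (auto simp: root_set_def)
  moreover have "x \<notin> root_set A G"
    using S_disj[of x] F.root_in_tree_set[of x] xS by blast
  ultimately obtain y where xy: "(x, y) \<in> G" using SA by (auto simp: root_set_def)
  have yS: "y \<notin> S"
    using exit xS xy by (auto simp: root_set_def GS_def)
  obtain q where q: "q \<in> root_set A F" "y \<in> tree_set F q"
    using F.ex_root[of y] xy G.E_sub by blast
  with yS roots have qG: "q \<in> root_set A G" by (auto simp: S_def)

  \<comment> \<open>Walks of \<open>F\<close> to \<open>r\<close> avoid \<open>S\<close>, and
    outside \<open>S\<close> the two forests agree.\<close>
  have sub: "tree_set F r \<subseteq> tree_set G r" if r: "r \<in> root_set A G" for r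
  proof
    fix a assume "a \<in> tree_set F r"
    then have "(a, r) \<in> F\<^sup>*" by (simp add: tree_set_def)
    then have "(a, r) \<in> G\<^sup>*"
    proof (induction rule: converse_rtrancl_induct)
      case (step a b)
      then have "a \<in> tree_set F r"
        by (auto simp: tree_set_def intro: converse_rtrancl_into_rtrancl)
      then have "(a, b) \<in> G" using S_disj[OF r] agree step.hyps by blast
      then show ?case using step.IH by (rule converse_rtrancl_into_rtrancl)
    qed simp
    then show "a \<in> tree_set G r" by (simp add: tree_set_def)
  qed
  \<comment> \<open>With \<open>x\<close> the only root of \<open>GS\<close>, every vertex of
    \<open>S\<close> reaches \<open>x\<close>, then \<open>y\<close>, then \<open>q\<close>.\<close>
  have S_q: "S \<subseteq> tree_set G q"
  proof
    fix a assume "a \<in> S"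
    then have "(a, x) \<in> GS\<^sup>*"
      using GS.ex_root exit by (auto simp: tree_set_def)
    then have "(a, x) \<in> G\<^sup>*"
      using rtrancl_mono[of GS G] by (auto simp: GS_def)
    moreover have "y \<in> tree_set G q"
      using sub[OF qG] q by blast
    ultimately show "a \<in> tree_set G q"
      using xy by (auto simp: tree_set_def intro: converse_rtrancl_into_rtrancl rtrancl_trans)
  qed
  \<comment> \<open>A vertex of the larger tree cannot lie in \<open>S\<close>, which belongs to
    \<open>q\<close>; so \<open>sub\<close>, applied to its own tree in \<open>F\<close>, identifies
    the root.\<close>
  have eq: "tree_set F r = tree_set G r" if r: "r \<in> root_set A G - {q}" for r
  proof (intro subset_antisym sub subsetI)
    fix a assume a: "a \<in> tree_set G r"
    then have "a \<in> A" using G.tree_set_subset r by blast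
    then obtain r' where r': "r' \<in> root_set A F" "a \<in> tree_set F r'"
      using F.ex_root by blast
    have "r' \<in> root_set A G"
    proof (rule ccontr)
      assume "\<not> ?thesis"
      then have "a \<in> S" using r' roots by (auto simp: S_def)
      then have "r = q" using S_q G.root_unique[OF _ qG a] r by blast
      with r show False by simp
    qed
    then have "r' = r" using sub r' a r G.root_unique[of r' r a] by blast
    with r' show "a \<in> tree_set F r" by simp
  qed (use r in simp)
  have arcs_eq: "F \<inter> tree_set F r \<times> tree_set F r = G \<inter> tree_set F r \<times> tree_set F r"
    if "r \<in> root_set A G" for r
    using S_disj[OF that] agree by blast

  have roots_dg: "roots (dg A F) = root_set A F" "roots (dg A G) = root_set A G"
    by (rule F.roots_dg G.roots_dg)+
  have trees: "rooted_tree (dg A F) r = dg (tree_set F r) (F \<inter> tree_set F r \<times> tree_set F r)"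
      "rooted_tree (dg A G) r = dg (tree_set G r) (G \<inter> tree_set G r \<times> tree_set G r)"
    if "r \<in> root_set A G" for r
    using F.rooted_tree_dg[of r] G.rooted_tree_dg[of r] that roots by (simp_all add: dg_restrict)
  have s_tree: "verts (rooted_tree (dg A F) s) = S"
    using F.rooted_tree_dg[OF s] by (simp add: S_def)
  have tree_eq: "rooted_tree (dg A F) r = rooted_tree (dg A G) r"
    if "r \<in> root_set A G - {q}" for r
    using trees[of r] arcs_eq[of r] eq[OF that] that by simp
  have tree_q: "subgraph (rooted_tree (dg A F) q) (rooted_tree (dg A G) q)"
    unfolding trees[OF qG] arcs_eq[OF qG] subgraph_dg_iff using sub[OF qG] by blast
  have tree_S: "in_tree (dg A G \<restriction> S)"
    unfolding in_tree_def dg_restrict GS_def[symmetric] GS.card_wccs_dg exit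
    using in_forest_dg_iff[OF GS.finite_A GS.E_sub] GS.rel_forest_axioms by simp

  have fin: "finite (root_set A G)" using G.finite_A by (simp add: root_set_def)
  have card: "card (root_set A G) = k" using G by (simp add: rel_forests_def)
  \<comment> \<open>This keeps \<open>k - 1\<close> from being truncated in the enumeration of the
    roots.\<close>
  have k: "k \<noteq> 0" using card_gt_0_iff[of "root_set A G"] fin card qG by blast
  have "card (root_set A G - {q}) = k - 1"
    using qG card by simp
  then obtain h where h: "bij_betw h {1..k - 1} (root_set A G - {q})"
    using ex_bij_betw_nat_finite_1[of "root_set A G - {q}"] fin by auto
  define r where "r = h(k := q, k + 1 := s)"
  have r_small: "r i = h i" if "i \<in> {1..k - 1}" for i
    using that k by (auto simp: r_def)
  have r_simps: "r k = q" "r (k + 1) = s" by (auto simp: r_def)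
  have "bij_betw r {1..k - 1} (root_set A G - {q})"
    using h by (subst bij_betw_cong[OF r_small])
  then have "bij_betw r ({1..k - 1} \<union> {k}) (root_set A G - {q} \<union> {r k})"
    by (rule notIn_Un_bij_betw[rotated 2]) (use k in \<open>auto simp: r_simps\<close>)
  moreover have "{1..k - 1} \<union> {k} = {1..k}" using k by auto
  moreover have "root_set A G - {q} \<union> {r k} = root_set A G" using qG r_simps by blast
  ultimately have bij_k: "bij_betw r {1..k} (root_set A G)" by (simp only:)
  then have "bij_betw r ({1..k} \<union> {k + 1}) (root_set A G \<union> {r (k + 1)})"
    by (rule notIn_Un_bij_betw[rotated 2]) (use roots r_simps(2) in simp_all)
  moreover have "{1..k} \<union> {k + 1} = {1..k + 1}" by auto
  moreover have "root_set A G \<union> {r (k + 1)} = root_set A F" using roots s r_simps by blast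
  ultimately have bij: "bij_betw r {1..k + 1} (root_set A F)" by (simp only:)
  have "r i \<in> root_set A G - {q}" if "i \<in> {1..k - 1}" for i
    using that r_small h by (metis bij_betwE)
  then have "\<forall>i\<in>{1..k - 1}. rooted_tree (dg A F) (r i) = rooted_tree (dg A G) (r i)"
    using tree_eq by blast
  moreover have "dg A F \<in> spanning_forests (dg A V) (k + 1)"
    "dg A G \<in> spanning_forests (dg A V) k"
    using F G spanning_forests_dg[OF F.finite_A V] by auto
  ultimately show ?thesis
    unfolding ancestor_def roots_dg
    using bij bij_betw_imp_surj_on[OF bij_k] tree_q tree_S s_tree
    by (intro conjI exI[of _ r]) (simp_all only: r_simps)
qed

section \<open>Existence of minimal forests and the extremal choice\<close>

lemma finite_rel_forests: "finite A \<Longrightarrow> V \<subseteq> A \<times> A \<Longrightarrow> finite (rel_forests A V k)"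
  by (rule finite_subset[of _ "Pow V"]) (auto simp: rel_forests_def finite_subset)

lemma min_rel_forests_nonempty:
  assumes "finite A" "V \<subseteq> A \<times> A" "rel_forests A V k \<noteq> {}"
  shows "min_rel_forests A V w k \<noteq> {}"
  using arg_min_if_finite[OF finite_rel_forests[OF assms(1,2)] assms(3), of "sum w"]
  by (auto simp: min_rel_forests_def not_less)

text \<open>Deleting an arc makes its tail a new root. There is an arc to delete, since without arcs
  all of \<open>A\<close> would be roots.\<close>

lemma rel_forests_Suc_nonempty:
  assumes "E \<in> rel_forests A V k" "k < card A"
  shows "rel_forests A V (k + 1) \<noteq> {}"
proof -
  interpret rel_forest A E using assms(1) by (simp add: rel_forests_def)
  have "E \<noteq> {}"
    using assms by (auto simp: rel_forests_def root_set_def)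
  then obtain a b where ab: "(a, b) \<in> E" by auto
  have "root_set A (E - {(a, b)}) = insert a (root_set A E)"
    using ab E_sub sv by (auto simp: root_set_def single_valued_def)
  moreover have "a \<notin> root_set A E" using ab by (auto simp: root_set_def)
  moreover have "finite (root_set A E)" using finite_A by (simp add: root_set_def)
  ultimately have "card (root_set A (E - {(a, b)})) = k + 1"
    using assms(1) by (simp add: rel_forests_def)
  moreover have "rel_forest A (E - {(a, b)})"
    using finite_A E_sub acyclic_subset[OF acyc] single_valued_subset[OF _ sv]
    by unfold_locales auto
  ultimately have "E - {(a, b)} \<in> rel_forests A V (k + 1)"
    using assms(1) by (auto simp: rel_forests_def)
  then show ?thesis by blast
qed

lemma ex_min_descendant:
  assumes "finite A" "V \<subseteq> A \<times> A" and F: "F \<in> min_rel_forests A V w (k + 1)"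
    and "rel_forests A V k \<noteq> {}"
  shows "\<exists>G \<in> min_rel_forests A V w k. ancestor (dg A V) k (dg A F) (dg A G)"
proof -
  have bound: "card (F \<inter> G) \<le> card F" for G
    using F rel_forest.finite_E
    by (intro card_mono) (auto simp: min_rel_forests_def rel_forests_def)
  obtain G0 where G0: "G0 \<in> min_rel_forests A V w k"
    using min_rel_forests_nonempty[OF assms(1,2,4)] by blast
  have "\<exists>G. G \<in> min_rel_forests A V w k \<and>
      (\<forall>G'. G' \<in> min_rel_forests A V w k \<longrightarrow> card (F \<inter> G') \<le> card (F \<inter> G))"
    by (rule ex_has_greatest_nat[where P = "\<lambda>G. G \<in> min_rel_forests A V w k"
          and b = "Suc (card F)", OF G0]) (simp add: bound le_imp_less_Suc)
  then obtain G where G: "G \<in> min_rel_forests A V w k"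
    and max: "\<And>G'. G' \<in> min_rel_forests A V w k \<Longrightarrow> card (F \<inter> G') \<le> card (F \<inter> G)"
    by blast
  have "mix D F G = F"
    if D: "mix D F G \<in> rel_forests A V (k + 1)" "mix D G F \<in> rel_forests A V k" for D
  proof -
    have "card (F \<inter> mix D G F) \<le> card (F \<inter> G)"
      by (intro max mix_min_rel_forests[OF F G] D)
    moreover have "F \<inter> G \<subseteq> F \<inter> mix D G F" "finite (F \<inter> mix D G F)"
      using F rel_forest.finite_E[of A F]
      by (auto simp: mem_mix min_rel_forests_def rel_forests_def)
    ultimately have "F \<inter> G = F \<inter> mix D G F"
      by (simp add: card_seteq)
    \<comment> \<open>Off \<open>D\<close> the mix consists of arcs of \<open>F\<close>, so the
      equality puts these into \<open>G\<close>; hence \<open>mix D F G\<close> contains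
      \<open>F\<close>.\<close>
    then have "e \<in> F \<inter> G \<longleftrightarrow> e \<in> F \<inter> mix D G F" for e
      by (rule arg_cong)
    then have "F \<subseteq> mix D F G"
      by (fastforce simp: mem_mix)
    then show ?thesis
      using D(1) F by (intro rel_forest_eqI[symmetric]) (auto simp: min_rel_forests_def rel_forests_def)
  qed
  then show ?thesis
    using G F ancestor_dg[OF assms(2)] by (auto simp: min_rel_forests_def)
qed

lemma ex_min_ancestor:
  assumes "finite A" "V \<subseteq> A \<times> A" and G: "G \<in> min_rel_forests A V w k"
    and "k < card A"
  shows "\<exists>F \<in> min_rel_forests A V w (k + 1). ancestor (dg A V) k (dg A F) (dg A G)"
proof -
  have bound: "card (F \<inter> G) \<le> card G" for F
    using G rel_forest.finite_E
    by (intro card_mono) (auto simp: min_rel_forests_def rel_forests_def)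
  have "G \<in> rel_forests A V k" using G by (simp add: min_rel_forests_def)
  then have "rel_forests A V (k + 1) \<noteq> {}"
    using assms(4) by (rule rel_forests_Suc_nonempty)
  then obtain F0 where F0: "F0 \<in> min_rel_forests A V w (k + 1)"
    using min_rel_forests_nonempty[OF assms(1,2)] by blast
  have "\<exists>F. F \<in> min_rel_forests A V w (k + 1) \<and>
      (\<forall>F'. F' \<in> min_rel_forests A V w (k + 1) \<longrightarrow> card (F' \<inter> G) \<le> card (F \<inter> G))"
    by (rule ex_has_greatest_nat[where P = "\<lambda>F. F \<in> min_rel_forests A V w (k + 1)"
          and b = "Suc (card G)", OF F0]) (simp add: bound le_imp_less_Suc)
  then obtain F where F: "F \<in> min_rel_forests A V w (k + 1)"
    and max: "\<And>F'. F' \<in> min_rel_forests A V w (k + 1) \<Longrightarrow> card (F' \<inter> G) \<le> card (F \<inter> G)"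
    by blast
  have "mix D F G = F"
    if D: "mix D F G \<in> rel_forests A V (k + 1)" "mix D G F \<in> rel_forests A V k" for D
  proof -
    have "card (mix D F G \<inter> G) \<le> card (F \<inter> G)"
      by (intro max mix_min_rel_forests[OF F G] D)
    moreover have "F \<inter> G \<subseteq> mix D F G \<inter> G" "finite (mix D F G \<inter> G)"
      using G rel_forest.finite_E[of A G]
      by (auto simp: mem_mix min_rel_forests_def rel_forests_def)
    ultimately have "F \<inter> G = mix D F G \<inter> G"
      by (simp add: card_seteq)
    \<comment> \<open>Here the equality puts the arcs of \<open>G\<close> off \<open>D\<close> into
      \<open>F\<close>, so the inclusion is the reverse of the one for descendants.\<close>
    then have "e \<in> F \<inter> G \<longleftrightarrow> e \<in> mix D F G \<inter> G" for e
      by (rule arg_cong)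
    then have "mix D F G \<subseteq> F"
      by (fastforce simp: mem_mix split: if_splits)
    then show ?thesis
      using D(1) F by (intro rel_forest_eqI) (auto simp: min_rel_forests_def rel_forests_def)
  qed
  then show ?thesis
    using G F ancestor_dg[OF assms(2)] by (auto simp: min_rel_forests_def)
qed

theorem theorem1:
  fixes V :: "nat pair_pre_digraph" and v :: "nat \<times> nat \<Rightarrow> real" and N k :: nat
  assumes "pverts V = {1..N}"
    and "parcs V \<subseteq> {1..N} \<times> {1..N}"
    and "k \<in> {1..N - 1}"
    and "spanning_forests (with_proj V) k \<noteq> {}"
  shows "(\<forall>F \<in> min_forests (with_proj V) v (k + 1).
            \<exists>G \<in> min_forests (with_proj V) v k. descendant (with_proj V) k G F) \<and>
         (\<forall>G \<in> min_forests (with_proj V) v k.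
            \<exists>F \<in> min_forests (with_proj V) v (k + 1). ancestor (with_proj V) k F G)"
proof -
  have V: "with_proj V = dg {1..N} (parcs V)"
    using assms(1) by (simp add: with_proj_def)
  have ne: "rel_forests {1..N} (parcs V) k \<noteq> {}"
    using assms(2,4) unfolding V by (simp add: spanning_forests_dg)
  \<comment> \<open>The subtraction \<open>N - 1\<close> is truncated, but \<open>k \<ge> 1\<close>
    excludes \<open>N = 0\<close>.\<close>
  have k: "k < card {1..N}"
    using assms(3) by auto
  note fin = finite_atLeastAtMost[of 1 N]
  show ?thesis
    unfolding V min_forests_dg[OF fin assms(2)] ball_simps(9) bex_simps(7)
    using ex_min_descendant[OF fin assms(2) _ ne] ex_min_ancestor[OF fin assms(2) _ k]
    by (intro conjI ballI)
qed

end
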